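(* For any $w, w'\in\widehat{\mathfrak{H}}^{0}$ we have $Z_{q}(w\mathbin{\mathrm{sh}}w')=Z_{q}(w)\,Z_{q}(w')$, where $\mathrm{sh}$ is the integral shuffle product.
   Context: Fix a complex number $q$ with $0<|q|<1$ and set $[n]:=\frac{1-q^{n}}{1-q}$ for $n\ge 1$. Let $\hbar$ be a formal variable, $\mathcal{C}:=\mathbb{Q}[\hbar]$, and let $\mathfrak{H}$ be the non-commutative polynomial algebra over $\mathcal{C}$ freely generated by $x,y,\rho$. Set $\xi:=y-\rho$ and $z_{k}:=x^{k-1}y$ $(k\ge1)$. Let $\mathfrak{H}^{1}$ be the subalgebra of $\mathfrak{H}$ (freely) generated by the set $A:=\{\xi\}\cup\{z_{k}\}_{k\ge1}$, and let $\widehat{\mathfrak{H}}^{0}:=\mathcal{C}+\xi\mathfrak{H}^{1}+\sum_{k\ge2}z_{k}\mathfrak{H}^{1}$, a $\mathcal{C}$-submodule of $\mathfrak{H}^1$. $\mathbb{C}$ is regarded as a $\mathcal{C}$-module with $\hbar$ acting as multiplication by $1-q$. Let $\mathfrak{z}$ be the $\mathcal{C}$-submodule of $\mathfrak{H}$ generated by $A$. For $n\ge1$ let $u\mapsto I_{u}(n)$ be the $\mathcal{C}$-linear map $\mathfrak{z}\to\mathbb{C}$ with $I_{\xi}(n)=\frac{q^{n}}{[n]}$ and $I_{z_{k}}(n)=\frac{q^{(k-1)n}}{[n]^{k}}$. The $\mathcal{C}$-linear map $Z_{q}:\widehat{\mathfrak{H}}^{0}\to\mathbb{C}$ is defined by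 $Z_{q}(1)=1$ and, for a word $u_{1}\cdots u_{r}\in\widehat{\mathfrak{H}}^{0}$ with $r\ge1$, $u_{i}\in A$, by the absolutely convergent sum $Z_{q}(u_{1}\cdots u_{r})=\sum_{n_{1}>\cdots>n_{r}>0}\prod_{i=1}^{r}I_{u_{i}}(n_{i})$. Integral shuffle product: the $\mathcal{C}$-bilinear product $\mathrm{sh}$ on $\mathfrak{H}$ is defined inductively by $1\mathbin{\mathrm{sh}}w=w\mathbin{\mathrm{sh}}1=w$ and, for $u,v\in\{x,y,\rho\}$ and $w,w'\in\mathfrak{H}$, $uw\mathbin{\mathrm{sh}}vw'=u(w\mathbin{\mathrm{sh}}vw')+v(uw\mathbin{\mathrm{sh}}w')+\alpha(u,v)(w\mathbin{\mathrm{sh}}w')$, where $\alpha(x,x)=\hbar x$, $\alpha(x,y)=\alpha(y,x)=0$, $\alpha(y,y)=-y\rho$, and $\alpha(u,\rho)=\alpha(\rho,u)=-u\rho$ for $u\in\{x,y,\rho\}$. The submodule $\widehat{\mathfrak{H}}^{0}$ is closed under $\mathrm{sh}$. *)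

theory Defs
  imports "HOL-Analysis.Analysis" "HOL-Library.Poly_Mapping"
    "HOL-Computational_Algebra.Polynomial"
begin

text \<open>
  Words over an alphabet are lists, a monoid under concatenation (written additively). With this
  instance, the convolution product of \<^type>\<open>poly_mapping\<close> turns finitely supported functions on
  words into the free non-commutative algebra on the alphabet.
\<close>

instantiation list :: (type) monoid_add
begin

definition zero_list :: "'a list" where "zero_list = []"

definition plus_list :: "'a list \<Rightarrow> 'a list \<Rightarrow> 'a list" where "plus_list u v = u @ v"

instance
  by standard (simp_all add: zero_list_def plus_list_def)

end

text \<open>The coefficient ring is \<open>\<C> = \<rat>[\<hbar>]\<close>, with \<open>\<hbar>\<close> the polynomial variable.\<close>

type_synonym coeff_ring = "rat poly"

definition hbar :: coeff_ring where "hbar = [:0, 1:]"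

type_synonym 'a free_algebra = "'a list \<Rightarrow>\<^sub>0 coeff_ring"

definition fconst :: "coeff_ring \<Rightarrow> 'a free_algebra"
  where "fconst c = Poly_Mapping.single [] c"

definition scale :: "coeff_ring \<Rightarrow> 'a free_algebra \<Rightarrow> 'a free_algebra"
  where "scale c f = fconst c * f"

definition word :: "'a list \<Rightarrow> 'a free_algebra"
  where "word w = Poly_Mapping.single w 1"

definition lin_ext :: "(coeff_ring \<Rightarrow> 'b \<Rightarrow> 'b) \<Rightarrow> ('a list \<Rightarrow> 'b) \<Rightarrow> 'a free_algebra \<Rightarrow> 'b::ab_group_add"
  where "lin_ext s \<phi> f = (\<Sum>w\<in>Poly_Mapping.keys f. s (Poly_Mapping.lookup f w) (\<phi> w))"


datatype letter = X | Y | Rho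

type_synonym H = "letter free_algebra"

definition xH :: H where "xH = word [X]"
definition yH :: H where "yH = word [Y]"
definition \<rho>H :: H where "\<rho>H = word [Rho]"
definition \<xi>H :: H where "\<xi>H = yH - \<rho>H"

definition zH :: "nat \<Rightarrow> H" where "zH k = xH ^ (k - 1) * yH"

text \<open>
  The type \<open>gen\<close> indexes the set \<open>A = {\<xi>} \<union> {z\<^sub>k | k \<ge> 1}\<close>; note the shift: \<open>GZ k\<close> stands
  for \<open>z\<^sub>k\<^sub>+\<^sub>1\<close>.
\<close>

datatype gen = GXi | GZ nat

fun gen_elem :: "gen \<Rightarrow> H" where
  "gen_elem GXi = \<xi>H"
| "gen_elem (GZ k) = zH (Suc k)"

inductive_set H1 :: "H set" where
  const: "fconst c \<in> H1"
| gen: "gen_elem g \<in> H1"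
| add: "\<lbrakk>f \<in> H1; f' \<in> H1\<rbrakk> \<Longrightarrow> f + f' \<in> H1"
| mult: "\<lbrakk>f \<in> H1; f' \<in> H1\<rbrakk> \<Longrightarrow> f * f' \<in> H1"

definition H0_hat :: "H set"
  where "H0_hat = module.span scale
    ({1} \<union> {\<xi>H * f | f. f \<in> H1} \<union> {zH k * f | k f. k \<ge> 2 \<and> f \<in> H1})"

definition emb_word :: "gen list \<Rightarrow> H"
  where "emb_word us = prod_list (map gen_elem us)"

text \<open>
  The algebra homomorphism from the abstract free algebra on \<open>A\<close> to \<open>H\<close>; it is a bijection onto
  \<open>H1\<close> (lemmas \<open>inj_emb\<close> and \<open>range_emb\<close> below).
\<close>

definition emb :: "gen free_algebra \<Rightarrow> H"
  where "emb = lin_ext scale emb_word"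


definition qint :: "complex \<Rightarrow> nat \<Rightarrow> complex"
  where "qint q n = (1 - q ^ n) / (1 - q)"

text \<open>\<open>\<complex>\<close> as a module over the coefficient ring, with \<open>\<hbar>\<close> acting as \<open>1 - q\<close>.\<close>

definition cscale :: "complex \<Rightarrow> coeff_ring \<Rightarrow> complex \<Rightarrow> complex"
  where "cscale q c t = poly (map_poly of_rat c) (1 - q) * t"

fun Iq :: "complex \<Rightarrow> gen \<Rightarrow> nat \<Rightarrow> complex" where
  "Iq q GXi n = q ^ n / qint q n"
| "Iq q (GZ k) n = q ^ (k * n) / qint q n ^ Suc k"

text \<open>The list \<open>ns\<close> is the tuple \<open>n\<^sub>1 > \<dots> > n\<^sub>r > 0\<close>; the empty word gets the value \<open>1\<close>.\<close>

definition Zq_word :: "complex \<Rightarrow> gen list \<Rightarrow> complex"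
  where "Zq_word q us =
    (\<Sum>\<^sub>\<infinity>ns\<in>{ns. length ns = length us \<and> sorted_wrt (>) ns \<and> (\<forall>n\<in>set ns. n > 0)}.
      \<Prod>i<length us. Iq q (us ! i) (ns ! i))"

text \<open>
  Only the restriction to \<open>H0_hat\<close> is meaningful: elsewhere the infinite sums may diverge (and then
  have the dummy value \<open>0\<close>), or there is no preimage under \<open>emb\<close>.
\<close>

definition Zq :: "complex \<Rightarrow> H \<Rightarrow> complex"
  where "Zq q f = lin_ext (cscale q) (Zq_word q) (inv emb f)"


fun sh_corr :: "letter \<Rightarrow> letter \<Rightarrow> H" where
  "sh_corr X X = scale hbar xH"
| "sh_corr X Y = 0"
| "sh_corr Y X = 0"
| "sh_corr Y Y = - (yH * \<rho>H)"
| "sh_corr u Rho = - (word [u] * \<rho>H)"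
| "sh_corr Rho u = - (word [u] * \<rho>H)"

fun sh_word :: "letter list \<Rightarrow> letter list \<Rightarrow> H" where
  "sh_word [] w = word w"
| "sh_word w [] = word w"
| "sh_word (u # w) (v # w') =
     word [u] * sh_word w (v # w') + word [v] * sh_word (u # w) w' + sh_corr u v * sh_word w w'"

definition shuffle :: "H \<Rightarrow> H \<Rightarrow> H"  (infixl \<open>sh\<close> 70)
  where "f sh f' = lin_ext scale (\<lambda>w. lin_ext scale (sh_word w) f') f"


subsection \<open>Well-definedness\<close>

lemma module_scale: "module (scale :: _ \<Rightarrow> 'a free_algebra \<Rightarrow> _)"
proof
  fix a b :: coeff_ring and f g :: "'a free_algebra"
  show "scale a (f + g) = scale a f + scale a g"
    by (simp add: scale_def distrib_left)
  show "scale (a + b) f = scale a f + scale b f"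
    by (simp add: scale_def fconst_def single_add distrib_right)
  show "scale a (scale b f) = scale (a * b) f"
    by (simp add: scale_def fconst_def mult_single plus_list_def flip: mult.assoc)
  show "scale 1 f = f"
    by (simp add: scale_def fconst_def flip: zero_list_def)
qed

lemma module_cscale: "module (cscale q)"
proof -
  have *: "map_poly of_rat (a * b) = (map_poly of_rat a * map_poly of_rat b :: complex poly)"
    for a b
    by (rule poly_eqI) (simp add: coeff_map_poly coeff_mult of_rat_sum of_rat_mult)
  have "map_poly of_rat (a + b) = (map_poly of_rat a + map_poly of_rat b :: complex poly)" for a b
    by (rule poly_eqI) (simp add: coeff_map_poly of_rat_add)
  with * show ?thesis
    by unfold_locales (simp_all add: cscale_def algebra_simps)
qed

lemma lookup_scale:
  "Poly_Mapping.lookup (scale c f) w = c * Poly_Mapping.lookup f w"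
proof -
  have "scale c f = Poly_Mapping.map ((*) c) f"
    by (simp add: scale_def fconst_def mult_map_scale_conv_mult zero_list_def)
  then show ?thesis
    by (simp add: Poly_Mapping.map.rep_eq when_def)
qed

lemma lin_ext_superset:
  assumes "module s" "finite W" "Poly_Mapping.keys f \<subseteq> W"
  shows "lin_ext s \<phi> f = (\<Sum>w\<in>W. s (Poly_Mapping.lookup f w) (\<phi> w))"
  unfolding lin_ext_def
  using assms by (intro sum.mono_neutral_left)
    (auto simp: in_keys_iff module.scale_zero_left)

lemma lin_ext_module_hom:
  fixes \<phi> :: "'a list \<Rightarrow> 'b::ab_group_add"
  assumes "module s"
  shows "module_hom scale s (lin_ext s \<phi>)"
proof -
  interpret s: module s by (fact assms)
  interpret scale: module "scale :: _ \<Rightarrow> 'a free_algebra \<Rightarrow> _" by (fact module_scale)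
  show ?thesis
  proof
    fix f g :: "'a free_algebra" and c
    let ?W = "Poly_Mapping.keys f \<union> Poly_Mapping.keys g"
    have "Poly_Mapping.keys (f + g) \<subseteq> ?W"
      by (rule keys_add)
    then show "lin_ext s \<phi> (f + g) = lin_ext s \<phi> f + lin_ext s \<phi> g"
      by (simp add: lin_ext_superset[OF assms, of ?W] lookup_add s.scale_left_distrib sum.distrib)
    have "Poly_Mapping.keys (scale c f) \<subseteq> Poly_Mapping.keys f"
      by (auto simp: in_keys_iff lookup_scale)
    then show "lin_ext s \<phi> (scale c f) = s c (lin_ext s \<phi> f)"
      by (simp add: lin_ext_superset[OF assms, of "Poly_Mapping.keys f"] lookup_scale
          s.scale_sum_right)
  qed
qed

lemma lin_ext_word: "module s \<Longrightarrow> lin_ext s \<phi> (word w) = \<phi> w"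
  by (simp add: lin_ext_def word_def module.scale_one)

lemma scale_word: "scale c (word w) = Poly_Mapping.single w c"
  by (simp add: scale_def fconst_def word_def mult_single plus_list_def)

lemma word_mult: "word u * word v = word (u @ v)"
  by (simp add: word_def mult_single plus_list_def)

lemma free_algebra_induct [case_names zero add]:
  assumes "P 0"
    and "\<And>f c w. P f \<Longrightarrow> P (f + scale c (word w))"
  shows "P (f :: 'a free_algebra)"
proof (induction f rule: update_induct)
  case const
  then show ?case by (fact assms(1))
next
  case (update f w c)
  have "Poly_Mapping.update w c f = f + scale c (word w)"
    using update.hyps
    by (intro poly_mapping_eqI)
      (auto simp: scale_word lookup_update lookup_add lookup_single in_keys_iff when_def)
  then show ?case
    using assms(2) update by metis
qed

lemma hom_eqI:
  assumes "module_hom scale s \<phi>" "module_hom scale s \<psi>" "\<And>w. \<phi> (word w) = \<psi> (word w)"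
  shows "\<phi> f = \<psi> f"
proof -
  interpret \<phi>: module_hom scale s \<phi> by (fact assms)
  interpret \<psi>: module_hom scale s \<psi> by (fact assms)
  show ?thesis
    by (induction f rule: free_algebra_induct)
      (simp_all add: assms(3) \<phi>.add \<phi>.scale \<psi>.add \<psi>.scale)
qed

lemma scale_mult_right: "f * scale c g = scale c (f * g)"
proof -
  have "f * fconst c = fconst c * f"
    by (induction f rule: free_algebra_induct)
      (simp_all add: distrib_left distrib_right scale_word fconst_def mult_single plus_list_def
        mult.commute)
  then show ?thesis
    by (simp add: scale_def flip: mult.assoc)
qed

lemma scale_mult_left: "scale c f * g = scale c (f * g)"
  by (simp add: scale_def mult.assoc)

lemma mult_left_module_hom: "module_hom scale scale (\<lambda>g :: 'a free_algebra. f * g)"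
proof -
  interpret scale: module "scale :: _ \<Rightarrow> 'a free_algebra \<Rightarrow> _" by (fact module_scale)
  show ?thesis
    by standard (simp_all add: distrib_left scale_mult_right)
qed

lemma mult_right_module_hom: "module_hom scale scale (\<lambda>g :: 'a free_algebra. g * f)"
proof -
  interpret scale: module "scale :: _ \<Rightarrow> 'a free_algebra \<Rightarrow> _" by (fact module_scale)
  show ?thesis
    by standard (simp_all add: distrib_right scale_mult_left)
qed

lemma emb_module_hom: "module_hom scale scale emb"
  unfolding emb_def by (rule lin_ext_module_hom) (rule module_scale)

lemma emb_of_word: "emb (word us) = emb_word us"
  by (simp add: emb_def lin_ext_word module_scale)

lemma emb_mult: "emb (f * g) = emb f * emb g"
proof (rule hom_eqI[where \<phi> = "\<lambda>f. emb (f * g)" and \<psi> = "\<lambda>f. emb f * emb g" and s = scale])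
  show "module_hom scale scale (\<lambda>f. emb (f * g))"
    using module_hom_compose[OF mult_right_module_hom emb_module_hom] by (simp add: o_def)
  show "module_hom scale scale (\<lambda>f. emb f * emb g)"
    using module_hom_compose[OF emb_module_hom mult_right_module_hom] by (simp add: o_def)
  fix w
  show "emb (word w * g) = emb (word w) * emb g"
  proof (rule hom_eqI[where \<phi> = "\<lambda>g. emb (word w * g)" and \<psi> = "\<lambda>g. emb (word w) * emb g"
        and s = scale])
    show "module_hom scale scale (\<lambda>g. emb (word w * g))"
      using module_hom_compose[OF mult_left_module_hom emb_module_hom] by (simp add: o_def)
    show "module_hom scale scale (\<lambda>g. emb (word w) * emb g)"
      using module_hom_compose[OF emb_module_hom mult_left_module_hom] by (simp add: o_def)
    show "emb (word w * word w') = emb (word w) * emb (word w')" for w'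
      by (simp add: word_mult emb_of_word emb_word_def)
  qed
qed

lemma range_emb: "range emb = H1"
proof
  interpret emb: module_hom scale scale emb by (fact emb_module_hom)
  have emb_word_H1: "emb_word us \<in> H1" for us
  proof (induction us)
    case Nil
    have "1 = (fconst 1 :: H)"
      by (simp add: fconst_def flip: zero_list_def)
    then show ?case
      using H1.const[of 1] by (simp add: emb_word_def)
  qed (auto simp: emb_word_def intro: H1.intros)
  have "0 = (fconst 0 :: H)"
    by (simp add: fconst_def)
  then have "0 \<in> H1"
    using H1.const[of 0] by simp
  moreover have "scale c f \<in> H1" if "f \<in> H1" for c f
    using that by (auto simp: scale_def intro: H1.intros)
  ultimately have "emb f \<in> H1" for f
    by (induction f rule: free_algebra_induct)
      (auto simp: emb.add emb.scale emb_of_word emb_word_H1 intro: H1.intros)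
  then show "range emb \<subseteq> H1" by auto
  show "H1 \<subseteq> range emb"
  proof
    fix f assume "f \<in> H1"
    then show "f \<in> range emb"
    proof induction
      case (const c)
      have "emb (scale c (word [])) = scale c 1"
        by (simp add: emb.scale emb_of_word emb_word_def)
      then have "fconst c = emb (scale c (word []))"
        by (simp add: scale_def)
      then show ?case by (rule range_eqI)
    next
      case (gen g)
      have "gen_elem g = emb (word [g])"
        by (simp add: emb_of_word emb_word_def)
      then show ?case by (rule range_eqI)
    next
      case (add f f')
      then show ?case by (auto simp flip: emb.add)
    next
      case (mult f f')
      then show ?case by (auto simp flip: emb_mult)
    qed
  qed
qed

text \<open>A linear left inverse of \<open>emb\<close>.\<close>

fun shift_word :: "gen list \<Rightarrow> gen free_algebra" where
  "shift_word (GZ k # us) = word (GZ (Suc k) # us)"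
| "shift_word _ = 0"

fun decode_word :: "letter list \<Rightarrow> gen free_algebra" where
  "decode_word [] = 1"
| "decode_word (X # w) = lin_ext scale shift_word (decode_word w)"
| "decode_word (Y # w) = word [GZ 0] * decode_word w"
| "decode_word (Rho # w) = (word [GZ 0] - word [GXi]) * decode_word w"

lemma decode_emb: "lin_ext scale decode_word (emb f) = f"
proof -
  define D where "D = lin_ext scale decode_word"
  have D_hom: "module_hom scale scale D"
    unfolding D_def by (rule lin_ext_module_hom) (rule module_scale)
  interpret D: module_hom scale scale D by (fact D_hom)
  define S where "S = lin_ext scale shift_word"
  have S_hom: "module_hom scale scale S"
    unfolding S_def by (rule lin_ext_module_hom) (rule module_scale)
  have D_word: "D (word w) = decode_word w" for w
    by (simp add: D_def lin_ext_word module_scale)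
  have D_y: "D (yH * h) = word [GZ 0] * D h" for h
    using hom_eqI[OF module_hom_compose[OF mult_left_module_hom D_hom]
        module_hom_compose[OF D_hom mult_left_module_hom], of yH "word [GZ 0]" h]
    by (simp add: D_word word_mult yH_def)
  have D_rho: "D (\<rho>H * h) = (word [GZ 0] - word [GXi]) * D h" for h
    using hom_eqI[OF module_hom_compose[OF mult_left_module_hom D_hom]
        module_hom_compose[OF D_hom mult_left_module_hom], of \<rho>H "word [GZ 0] - word [GXi]" h]
    by (simp add: D_word word_mult \<rho>H_def)
  have D_x: "D (xH * h) = S (D h)" for h
    using hom_eqI[OF module_hom_compose[OF mult_left_module_hom D_hom]
        module_hom_compose[OF D_hom S_hom], of xH h]
    by (simp add: D_word word_mult xH_def S_def)
  have D_xs: "D (xH ^ k * (yH * h)) = word [GZ k] * D h" for k h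
  proof (induction k)
    case 0
    then show ?case by (simp add: D_y)
  next
    case (Suc k)
    have "S (word [GZ k] * g) = word [GZ (Suc k)] * g" for g
      using hom_eqI[OF module_hom_compose[OF mult_left_module_hom S_hom] mult_left_module_hom,
          of "word [GZ k]" "word [GZ (Suc k)]" g]
      by (simp add: S_def word_mult lin_ext_word module_scale)
    then show ?case
      using Suc by (simp add: D_x mult.assoc)
  qed
  have D_gen: "D (gen_elem g * h) = word [g] * D h" for g h
    by (cases g) (simp_all add: \<xi>H_def zH_def left_diff_distrib D.diff D_y D_rho D_xs mult.assoc)
  have "D (emb_word us) = word us" for us
  proof (induction us)
    case Nil
    have "1 = (word [] :: H)" "1 = (word [] :: gen free_algebra)"
      by (simp_all add: word_def flip: zero_list_def)
    then show ?case
      using D_word[of "[]"] by (simp add: emb_word_def)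
  next
    case (Cons g us)
    then show ?case
      using D_gen[of g "emb_word us"] by (simp add: emb_word_def word_mult)
  qed
  then have "D (emb f) = f"
    using hom_eqI[OF module_hom_compose[OF emb_module_hom D_hom] module.module_hom_id[OF module_scale], of f]
    by (simp add: emb_of_word)
  then show ?thesis by (simp add: D_def)
qed

lemma inj_emb: "inj emb"
  by (rule inj_on_inverseI) (rule decode_emb)

lemma Zq_emb: "Zq q (emb f) = lin_ext (cscale q) (Zq_word q) f"
  by (simp add: Zq_def inv_f_f inj_emb)

lemma Zq_emb_word: "Zq q (emb_word us) = Zq_word q us"
  by (simp add: Zq_emb lin_ext_word module_cscale flip: emb_of_word)

lemma word_shuffle_word: "word w sh word w' = sh_word w w'"
  by (simp add: shuffle_def lin_ext_word module_scale)

lemma Zq_one: "Zq q 1 = 1"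
proof -
  have "{ns :: nat list. length ns = 0 \<and> sorted_wrt (>) ns \<and> (\<forall>n\<in>set ns. n > 0)} = {[]}"
    by auto
  then show ?thesis
    using Zq_emb_word[of q "[]"] by (simp add: emb_word_def Zq_word_def)
qed

lemma H0_hat_subset_H1: "H0_hat \<subseteq> H1"
proof -
  interpret scale: module "scale :: _ \<Rightarrow> H \<Rightarrow> _" by (fact module_scale)
  have const: "0 = (fconst 0 :: H)" "1 = (fconst 1 :: H)"
    by (simp_all add: fconst_def flip: zero_list_def)
  have "scale.subspace H1"
    unfolding scale.subspace_def
    using H1.const[of 0] by (auto simp: scale_def const(1)[symmetric] intro: H1.intros)
  moreover have "\<xi>H \<in> H1"
    using H1.gen[of GXi] by simp
  moreover have "zH k \<in> H1" if "k \<ge> 2" for k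
    using H1.gen[of "GZ (k - 1)"] that by simp
  moreover have "1 \<in> H1"
    using H1.const[of 1] by (simp add: const)
  ultimately show ?thesis
    unfolding H0_hat_def by (intro scale.span_minimal) (auto intro: H1.mult)
qed

end

(*
  Interpret x, y, rho as operators on power series F = sum F_n t^n: x multiplies F_n by q^n/[n],
  y sends F to the series with coefficients (F_0 + ... + F_{n-1})/[n], and rho multiplies F by
  (1 - q) t/(1 - t). Applied to the constant series 1, a word u_1 ... u_r in A becomes the series
  whose n-th coefficient is the part of Z_q(u_1 ... u_r) with n_1 = n, so Z_q is evaluation at t = 1.
  The operators of x and y are q-integrals: F(t) - F(qt) determines F up to its constant term, and
  the q-Leibniz rule for F(t) - F(qt) is exactly the recursion that defines the integral shuffle
  product. Hence shuffles become products of power series, and Cauchy multiplication of the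
  absolutely convergent coefficient sums gives the theorem.
*)

theory Submission
  imports Defs
begin

unbundle fps_syntax
unbundle no vec_syntax

section \<open>Bilinearity and closure of the shuffle product\<close>

interpretation H: module "scale :: _ \<Rightarrow> 'a free_algebra \<Rightarrow> _"
  by (rule module_scale)

lemma shuffle_hom_left: "module_hom scale scale (\<lambda>f. f sh g)"
  unfolding shuffle_def by (rule lin_ext_module_hom) (rule module_scale)

text \<open>The definition is visibly linear only in its outer argument, the left one. Linearity in
  the right factor is checked with a word on the left and carried to sums by linearity on the
  left.\<close>

lemma shuffle_hom_right: "module_hom scale scale (\<lambda>g. f sh g)"
proof -
  have word: "module_hom scale scale (\<lambda>g. word w sh g)" for w
    unfolding shuffle_def lin_ext_word[OF module_scale]
    by (rule lin_ext_module_hom) (rule module_scale)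
  note simps = module_hom.zero[OF shuffle_hom_left] module_hom.add[OF shuffle_hom_left]
    module_hom.scale[OF shuffle_hom_left] module_hom.add[OF word] module_hom.scale[OF word]
  have "f sh (g + g') = f sh g + f sh g'" for g g'
    by (induction f rule: free_algebra_induct) (simp_all add: simps H.scale_right_distrib)
  moreover have "f sh scale c g = scale c (f sh g)" for c g
    by (induction f rule: free_algebra_induct)
      (simp_all add: simps H.scale_right_distrib mult.commute)
  ultimately show ?thesis
    by unfold_locales
qed

lemma shuffle_zero_left [simp]: "0 sh g = 0"
  by (rule module_hom.zero[OF shuffle_hom_left])

lemma shuffle_zero_right [simp]: "f sh 0 = 0"
  by (rule module_hom.zero[OF shuffle_hom_right])

lemma shuffle_add_left: "(f + f') sh g = f sh g + f' sh g"
  by (rule module_hom.add[OF shuffle_hom_left])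

lemma shuffle_add_right: "f sh (g + g') = f sh g + f sh g'"
  by (rule module_hom.add[OF shuffle_hom_right])

lemma shuffle_diff_left: "(f - f') sh g = f sh g - f' sh g"
  by (rule module_hom.diff[OF shuffle_hom_left])

lemma shuffle_diff_right: "f sh (g - g') = f sh g - f sh g'"
  by (rule module_hom.diff[OF shuffle_hom_right])

lemma shuffle_scale_left: "scale c f sh g = scale c (f sh g)"
  by (rule module_hom.scale[OF shuffle_hom_left])

lemma shuffle_scale_right: "f sh scale c g = scale c (f sh g)"
  by (rule module_hom.scale[OF shuffle_hom_right])

lemmas shuffle_linear = shuffle_add_left shuffle_add_right shuffle_scale_left shuffle_scale_right

lemma shuffle_letters:
  "(word [u] * f) sh (word [v] * g) =
    word [u] * (f sh (word [v] * g)) + word [v] * ((word [u] * f) sh g) + sh_corr u v * (f sh g)"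
proof (induction f rule: free_algebra_induct)
  case (add f c w)
  have "(word [u] * word w) sh (word [v] * g) = word [u] * (word w sh (word [v] * g)) +
      word [v] * ((word [u] * word w) sh g) + sh_corr u v * (word w sh g)"
  proof (induction g rule: free_algebra_induct)
    case (add g d w')
    then show ?case
      by (simp add: shuffle_linear distrib_left scale_mult_right word_mult word_shuffle_word
          H.scale_right_distrib)
  qed simp
  with add show ?case
    by (simp add: shuffle_linear distrib_left scale_mult_right H.scale_right_distrib)
qed simp

lemma sh_corr_commute: "sh_corr u v = sh_corr v u"
  by (cases u; cases v) simp_all

lemma sh_word_commute: "sh_word w w' = sh_word w' w"
proof (induction w w' rule: sh_word.induct)
  case (1 w)
  then show ?case by (cases w) simp_all
next
  case (3 u w v w')
  then show ?case by (simp add: sh_corr_commute[of u v])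
qed simp

lemma shuffle_commute: "f sh g = g sh f"
proof (induction f rule: free_algebra_induct)
  case (add f c w)
  have "word w sh g = g sh word w"
    by (induction g rule: free_algebra_induct)
      (simp_all add: shuffle_linear word_shuffle_word sh_word_commute[of w])
  with add show ?case by (simp add: shuffle_linear)
qed simp

lemma word_Nil: "word [] = 1"
  by (simp add: word_def flip: zero_list_def)

lemma shuffle_word_Nil: "word [] sh g = g"
  using hom_eqI[OF shuffle_hom_right H.module_hom_id, of "word []" g]
  by (simp add: word_shuffle_word)

text \<open>The letter \<open>\<rho>\<close> acts by multiplication with a function, so it can be pulled out of shuffles.\<close>

lemma shuffle_rho_left: "(\<rho>H * f) sh g = \<rho>H * (f sh g)"
proof (induction g rule: free_algebra_induct)
  case (add g c w)
  have "(\<rho>H * f) sh word w = \<rho>H * (f sh word w)"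
  proof (induction w)
    case Nil
    then show ?case by (simp add: shuffle_commute[of _ "word []"] shuffle_word_Nil)
  next
    case (Cons v w)
    have "sh_corr Rho v = - (word [v] * \<rho>H)"
      by (cases v) simp_all
    moreover have "word (v # w) = word [v] * word w"
      by (simp add: word_mult)
    ultimately show ?case
      using shuffle_letters[of Rho f v "word w"] Cons
      by (simp add: \<rho>H_def[symmetric] mult.assoc)
  qed
  with add show ?case
    by (simp add: shuffle_linear distrib_left scale_mult_right)
qed simp

lemma shuffle_rho_right: "f sh (\<rho>H * g) = \<rho>H * (f sh g)"
  using shuffle_rho_left shuffle_commute by metis

section \<open>Shuffle recursions for the heads x, y and \<xi>\<close>

lemma shuffle_xx:
  "(xH * f) sh (xH * g) = xH * (f sh (xH * g) + (xH * f) sh g + scale hbar (f sh g))"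
  using shuffle_letters[of X f X g]
  by (simp add: xH_def distrib_left scale_mult_left scale_mult_right)

lemma shuffle_xy: "(xH * f) sh (yH * g) = xH * (f sh (yH * g)) + yH * ((xH * f) sh g)"
  using shuffle_letters[of X f Y g] by (simp add: xH_def yH_def)

lemma shuffle_yy:
  "(yH * f) sh (yH * g) = yH * (f sh (yH * g) + (yH * f) sh g - \<rho>H * (f sh g))"
  using shuffle_letters[of Y f Y g]
  by (simp add: yH_def distrib_left right_diff_distrib mult.assoc)

text \<open>In this and the next two recursions \<xi> is expanded as y - \<rho> and each leading
  \<rho> is pulled out of the shuffle; the terms then regroup under the heads x, y and \<xi>. Behind
  x the other factor carries y in place of \<xi>, on which the closure proof relies.\<close>

lemma shuffle_x_xi: "(xH * f) sh (\<xi>H * g) = xH * (f sh (yH * g)) + \<xi>H * ((xH * f) sh g)"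
  by (simp add: \<xi>H_def left_diff_distrib shuffle_diff_right shuffle_rho_right shuffle_xy)

lemma shuffle_xi_y: "(\<xi>H * f) sh (yH * g) = \<xi>H * (f sh (yH * g)) + yH * ((\<xi>H * f) sh g)"
  by (simp add: \<xi>H_def left_diff_distrib right_diff_distrib distrib_left shuffle_diff_left
      shuffle_rho_left shuffle_yy mult.assoc)

lemma shuffle_xi_xi:
  "(\<xi>H * f) sh (\<xi>H * g) = \<xi>H * (f sh (yH * g) + (yH * f) sh g - \<rho>H * (f sh g))"
  by (simp add: \<xi>H_def left_diff_distrib right_diff_distrib distrib_left shuffle_diff_left
      shuffle_diff_right shuffle_rho_left shuffle_rho_right shuffle_yy mult.assoc)

section \<open>Closure of the span of admissible words under the shuffle\<close>

fun admissible :: "gen list \<Rightarrow> bool" where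
  "admissible (GZ 0 # us) = False"
| "admissible us = True"

fun z_headed :: "gen list \<Rightarrow> bool" where
  "z_headed (GZ k # us) = True"
| "z_headed us = False"

definition word_span :: "(gen list \<Rightarrow> bool) \<Rightarrow> H set"
  where "word_span P = H.span {emb_word us | us. P us}"

lemma subspace_word_span: "H.subspace (word_span P)"
  unfolding word_span_def by (rule H.subspace_span)

lemmas word_span_closed =
  H.subspace_0[OF subspace_word_span] H.subspace_add[OF subspace_word_span]
  H.subspace_diff[OF subspace_word_span] H.subspace_scale[OF subspace_word_span]

lemma emb_word_in_span: "P us \<Longrightarrow> emb_word us \<in> word_span P"
  unfolding word_span_def by (rule H.span_base) auto

lemma word_span_hom_closed:
  assumes "module_hom scale scale \<phi>" "f \<in> word_span P"
    and "\<And>us. P us \<Longrightarrow> \<phi> (emb_word us) \<in> V" "H.subspace V"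
  shows "\<phi> f \<in> V"
proof -
  interpret \<phi>: module_hom scale scale \<phi> by fact
  have "word_span P \<subseteq> \<phi> -` V"
    unfolding word_span_def using assms(3)
    by (intro H.span_minimal \<phi>.subspace_vimage assms(4)) auto
  with assms(2) show ?thesis by auto
qed

lemma word_span_mono: "f \<in> word_span P \<Longrightarrow> (\<And>us. P us \<Longrightarrow> Q us) \<Longrightarrow> f \<in> word_span Q"
  using H.span_mono[of "{emb_word us | us. P us}" "{emb_word us | us. Q us}"]
  unfolding word_span_def by blast

lemma emb_word_Cons: "emb_word (g # us) = gen_elem g * emb_word us"
  by (simp add: emb_word_def)

lemma emb_word_GZ_0: "emb_word (GZ 0 # us) = yH * emb_word us"
  by (simp add: emb_word_Cons zH_def)

lemma emb_word_GZ_Suc: "emb_word (GZ (Suc k) # us) = xH * emb_word (GZ k # us)"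
  by (simp add: emb_word_Cons zH_def mult.assoc)

lemma emb_word_GXi: "emb_word (GXi # us) = \<xi>H * emb_word us"
  by (simp add: emb_word_Cons)

lemma y_word_span: "f \<in> word_span (\<lambda>_. True) \<Longrightarrow> yH * f \<in> word_span z_headed"
  by (erule word_span_hom_closed[OF mult_left_module_hom])
    (auto simp: subspace_word_span simp flip: emb_word_GZ_0 intro: emb_word_in_span)

lemma xi_word_span:
  "f \<in> word_span (\<lambda>_. True) \<Longrightarrow> \<xi>H * f \<in> word_span admissible"
  by (erule word_span_hom_closed[OF mult_left_module_hom])
    (auto simp: subspace_word_span simp flip: emb_word_GXi intro: emb_word_in_span)

text \<open>Prefixing x turns a head z_k into z_(k+1), whose index is at least 2, so admissibility
  comes for free.\<close>

lemma x_word_span: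
  "f \<in> word_span z_headed \<Longrightarrow> xH * f \<in> word_span (\<lambda>us. z_headed us \<and> admissible us)"
proof (erule word_span_hom_closed[OF mult_left_module_hom])
  fix us assume "z_headed us"
  then obtain k vs where "us = GZ k # vs"
    by (cases us rule: z_headed.cases) auto
  then show "xH * emb_word us \<in> word_span (\<lambda>us. z_headed us \<and> admissible us)"
    by (auto simp flip: emb_word_GZ_Suc intro: emb_word_in_span)
qed (rule subspace_word_span)

lemma rho_word_span:
  assumes "f \<in> word_span (\<lambda>_. True)"
  shows "\<rho>H * f \<in> word_span (\<lambda>_. True)"
proof -
  have "\<rho>H * f = yH * f - \<xi>H * f"
    by (simp add: \<xi>H_def left_diff_distrib)
  moreover have "yH * f \<in> word_span (\<lambda>_. True)" "\<xi>H * f \<in> word_span (\<lambda>_. True)"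
    using y_word_span[OF assms] xi_word_span[OF assms] by (auto intro: word_span_mono)
  ultimately show ?thesis
    by (simp add: word_span_closed)
qed

text \<open>The length in letters x, y, \<rho>, with \<xi> counted once. The recursions peel off
  single letters, turning z_(k+1) into z_k, so the number of generators need not drop; trading \<xi>
  for y keeps the weight.\<close>

fun weight :: "gen list \<Rightarrow> nat" where
  "weight [] = 0"
| "weight (GXi # us) = Suc (weight us)"
| "weight (GZ k # us) = Suc k + weight us"

text \<open>
  The inner shuffles that end up behind a letter \<open>x\<close> must again start with some \<open>z\<^sub>k\<close>, because
  \<open>x\<xi>\<close> does not lie in \<open>\<HH>\<^sup>1\<close>; hence the three simultaneous claims.
\<close>

lemma shuffle_emb_words:
  "emb_word us sh emb_word vs \<in> word_span (\<lambda>_. True) \<and>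
   (z_headed us \<longrightarrow> z_headed vs \<longrightarrow> emb_word us sh emb_word vs \<in> word_span z_headed) \<and>
   (admissible us \<longrightarrow> admissible vs \<longrightarrow> emb_word us sh emb_word vs \<in> word_span admissible)"
  (is "?P us vs")
proof (induction "weight us + weight vs" arbitrary: us vs rule: less_induct)
  case less
  note any = word_span_mono[where Q = "\<lambda>_. True", OF _ TrueI]
  note span = word_span_closed y_word_span xi_word_span x_word_span rho_word_span
  have nil: "?P [] vs" for vs
  proof -
    have "emb_word [] sh emb_word vs = emb_word vs"
      using shuffle_word_Nil[of "emb_word vs"] by (simp add: emb_word_def word_Nil)
    then show ?thesis
      by (simp add: emb_word_in_span)
  qed
  have z_heads: "emb_word (GZ k # us') sh emb_word (GZ l # vs') \<in> word_span z_headed"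
    if "weight (GZ k # us') + weight (GZ l # vs') < weight us + weight vs" for k l us' vs'
    using less[OF that] by simp
  have xi_xi: "?P (GXi # us') (GXi # vs')"
    if w: "weight (GXi # us') + weight (GXi # vs') = weight us + weight vs" for us' vs'
  proof -
    have "emb_word (GXi # us') sh emb_word (GXi # vs') \<in> word_span admissible"
      using less[of us' "GZ 0 # vs'"] less[of "GZ 0 # us'" vs'] less[of us' vs'] w
      unfolding emb_word_GXi shuffle_xi_xi emb_word_GZ_0 by (intro span) auto
    then show ?thesis by (auto intro: any)
  qed
  have xi_y: "?P (GXi # us') (GZ 0 # vs')"
    if w: "weight (GXi # us') + weight (GZ 0 # vs') = weight us + weight vs" for us' vs'
  proof -
    have "emb_word (GXi # us') sh emb_word (GZ 0 # vs') \<in> word_span (\<lambda>_. True)"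
      using less[of us' "GZ 0 # vs'"] less[of "GXi # us'" vs'] w
      unfolding emb_word_GXi shuffle_xi_y emb_word_GZ_0
      by (intro word_span_closed any[OF xi_word_span] any[OF y_word_span]) auto
    then show ?thesis by simp
  qed
  have x_xi: "?P (GZ (Suc k) # us') (GXi # vs')"
    if w: "weight (GZ (Suc k) # us') + weight (GXi # vs') = weight us + weight vs" for k us' vs'
  proof -
    \<comment> \<open>The tail behind x is shuffled with a word headed by y, not \<xi>, so both
      factors start with some z and x may be prefixed to the result.\<close>
    have "emb_word (GZ (Suc k) # us') sh emb_word (GXi # vs') \<in> word_span admissible"
      using z_heads[of k us' 0 vs'] less[of "GZ (Suc k) # us'" vs'] w
      unfolding emb_word_GXi shuffle_x_xi emb_word_GZ_0 emb_word_GZ_Suc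
      by (intro word_span_closed xi_word_span word_span_mono[OF x_word_span, of _ admissible]) auto
    then show ?thesis by (auto intro: any)
  qed
  have y_y: "?P (GZ 0 # us') (GZ 0 # vs')"
    if w: "weight (GZ 0 # us') + weight (GZ 0 # vs') = weight us + weight vs" for us' vs'
  proof -
    have "emb_word (GZ 0 # us') sh emb_word (GZ 0 # vs') \<in> word_span z_headed"
      using less[of us' "GZ 0 # vs'"] less[of "GZ 0 # us'" vs'] less[of us' vs'] w
      unfolding shuffle_yy emb_word_GZ_0 by (intro span) auto
    then show ?thesis by (auto intro: any)
  qed
  have x_y: "?P (GZ (Suc k) # us') (GZ 0 # vs')"
    if w: "weight (GZ (Suc k) # us') + weight (GZ 0 # vs') = weight us + weight vs" for k us' vs'
  proof -
    have "emb_word (GZ (Suc k) # us') sh emb_word (GZ 0 # vs') \<in> word_span z_headed"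
      using z_heads[of k us' 0 vs'] less[of "GZ (Suc k) # us'" vs'] w
      unfolding shuffle_xy emb_word_GZ_0 emb_word_GZ_Suc
      by (intro word_span_closed y_word_span word_span_mono[OF x_word_span, of _ z_headed]) auto
    then show ?thesis by (auto intro: any)
  qed
  have x_x: "?P (GZ (Suc k) # us') (GZ (Suc l) # vs')"
    if w: "weight (GZ (Suc k) # us') + weight (GZ (Suc l) # vs') = weight us + weight vs"
    for k l us' vs'
  proof -
    have "emb_word (GZ (Suc k) # us') sh emb_word (GZ (Suc l) # vs')
        \<in> word_span (\<lambda>us. z_headed us \<and> admissible us)"
      using z_heads[of k us' "Suc l" vs'] z_heads[of "Suc k" us' l vs'] z_heads[of k us' l vs'] w
      unfolding shuffle_xx emb_word_GZ_Suc by (intro word_span_closed x_word_span) auto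
    then show ?thesis by (auto intro: word_span_mono)
  qed
  have cases: thesis
    if "ws = [] \<Longrightarrow> thesis" "\<And>ws'. ws = GXi # ws' \<Longrightarrow> thesis" "\<And>ws'. ws = GZ 0 # ws' \<Longrightarrow> thesis"
      "\<And>k ws'. ws = GZ (Suc k) # ws' \<Longrightarrow> thesis" for ws thesis
    using that by (cases ws rule: weight.cases) (auto, metis not0_implies_Suc)
  have sym: "?P us vs" if "?P vs us"
    using that shuffle_commute by metis
  \<comment> \<open>A word is empty or has head \<xi>, z_1 or z_k with k >= 2; commutativity reduces
    the sixteen pairs to the seven facts above.\<close>
  show ?case
    by (rule cases[of us]; rule cases[of vs])
      (use nil xi_xi xi_y x_xi y_y x_y x_x in \<open>metis sym add.commute\<close>)+
qed

lemma shuffle_word_span: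
  assumes "f \<in> word_span P" "g \<in> word_span P"
    and "\<And>us vs. P us \<Longrightarrow> P vs \<Longrightarrow> emb_word us sh emb_word vs \<in> V" "H.subspace V"
  shows "f sh g \<in> V"
proof (rule word_span_hom_closed[OF shuffle_hom_left assms(1) _ assms(4)])
  fix us assume "P us"
  then show "emb_word us sh g \<in> V"
    by (intro word_span_hom_closed[OF shuffle_hom_right assms(2) _ assms(4)] assms(3))
qed

lemma shuffle_admissible:
  "f \<in> word_span admissible \<Longrightarrow> g \<in> word_span admissible \<Longrightarrow> f sh g \<in> word_span admissible"
  by (rule shuffle_word_span[where P = admissible, OF _ _ _ subspace_word_span]) (simp_all add: shuffle_emb_words)

lemma H1_subset_word_span: "H1 \<subseteq> word_span (\<lambda>_. True)"
proof -
  interpret emb: module_hom scale scale emb by (fact emb_module_hom)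
  have "emb f \<in> word_span (\<lambda>_. True)" for f
    by (induction f rule: free_algebra_induct)
      (simp_all add: emb.add emb.scale emb_of_word word_span_closed emb_word_in_span)
  then show ?thesis
    by (auto simp flip: range_emb)
qed

lemma H0_hat_subset_word_span: "H0_hat \<subseteq> word_span admissible"
proof -
  have "zH k * f \<in> word_span admissible" if "k \<ge> 2" "f \<in> H1" for k f
  proof -
    have "emb_word (GZ (k - 1) # us) \<in> word_span admissible" for us
      using that(1) by (intro emb_word_in_span) (cases "k - 1", auto)
    then show ?thesis
      using word_span_hom_closed[OF mult_left_module_hom, of f "\<lambda>_. True" "zH k"]
        that H1_subset_word_span subspace_word_span
      by (auto simp: emb_word_Cons)
  qed
  moreover have "1 \<in> word_span admissible"
    using emb_word_in_span[of admissible "[]"] by (simp add: emb_word_def)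
  ultimately show ?thesis
    unfolding H0_hat_def using H1_subset_word_span
    by (intro H.span_minimal subspace_word_span) (auto intro: xi_word_span)
qed

section \<open>Shuffles as products of power series\<close>

definition fps_scale :: "complex \<Rightarrow> coeff_ring \<Rightarrow> complex fps \<Rightarrow> complex fps"
  where "fps_scale q c F = fps_const (cscale q c 1) * F"

lemma fps_scale_nth: "fps_scale q c F $ n = cscale q c (F $ n)"
  by (simp add: fps_scale_def cscale_def)

lemma module_fps_scale: "module (fps_scale q)"
proof -
  interpret C: module "cscale q" by (rule module_cscale)
  show ?thesis
    by unfold_locales
      (simp_all add: fps_eq_iff fps_scale_nth C.scale_right_distrib C.scale_left_distrib)
qed

text \<open>For |q| < 1, the result G solves G(t) - G(qt) = (1 - q) F(qt) for x, if F has no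
  constant term, and G(t) - G(qt) = (1 - q) t/(1 - t) F(t) for y. Since \<open>qint q 0 = 0\<close>
  and division by zero gives zero, G has constant term 0.\<close>

fun letter_op :: "complex \<Rightarrow> letter \<Rightarrow> complex fps \<Rightarrow> complex fps" where
  "letter_op q X F = Abs_fps (\<lambda>n. q ^ n / qint q n * F $ n)"
| "letter_op q Y F = Abs_fps (\<lambda>n. (\<Sum>m<n. F $ m) / qint q n)"
| "letter_op q Rho F = Abs_fps (\<lambda>n. (1 - q) * (\<Sum>m<n. F $ m))"

definition word_fps :: "complex \<Rightarrow> letter list \<Rightarrow> complex fps"
  where "word_fps q w = foldr (letter_op q) w 1"

definition fps_of :: "complex \<Rightarrow> H \<Rightarrow> complex fps"
  where "fps_of q = lin_ext (fps_scale q) (word_fps q)"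

lemma letter_op_hom: "module_hom (fps_scale q) (fps_scale q) (letter_op q u)"
proof -
  interpret F: module "fps_scale q" by (rule module_fps_scale)
  have "letter_op q u (F + G) = letter_op q u F + letter_op q u G" for F G
    by (cases u) (simp_all add: fps_eq_iff sum.distrib add_divide_distrib distrib_left)
  moreover have "letter_op q u (fps_scale q c F) = fps_scale q c (letter_op q u F)" for c F
    by (cases u) (simp_all add: fps_eq_iff fps_scale_def mult.left_commute
      flip: sum_distrib_left)
  ultimately show ?thesis
    by unfold_locales
qed

lemma fps_of_hom: "module_hom scale (fps_scale q) (fps_of q)"
  unfolding fps_of_def by (rule lin_ext_module_hom) (rule module_fps_scale)

lemma fps_of_word: "fps_of q (word w) = word_fps q w"
  unfolding fps_of_def by (rule lin_ext_word) (rule module_fps_scale)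

lemma fps_of_letter_mult: "fps_of q (word [u] * f) = letter_op q u (fps_of q f)"
proof (rule hom_eqI[where \<phi> = "\<lambda>f. fps_of q (word [u] * f)"
      and \<psi> = "\<lambda>f. letter_op q u (fps_of q f)" and s = "fps_scale q"])
  show "module_hom scale (fps_scale q) (\<lambda>f. fps_of q (word [u] * f))"
    using module_hom_compose[OF mult_left_module_hom fps_of_hom] by (simp add: o_def)
  show "module_hom scale (fps_scale q) (\<lambda>f. letter_op q u (fps_of q f))"
    using module_hom_compose[OF fps_of_hom letter_op_hom] by (simp add: o_def)
qed (simp add: word_mult fps_of_word word_fps_def)

section \<open>The dilation F(t) -> F(qt) and its difference operator\<close>

definition dilate :: "complex \<Rightarrow> complex fps \<Rightarrow> complex fps"
  where "dilate q F = Abs_fps (\<lambda>n. q ^ n * F $ n)"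

lemma dilate_mult: "dilate q (F * G) = dilate q F * dilate q G"
proof (rule fps_ext)
  fix n
  have "q ^ n * (F $ i * G $ (n - i)) = q ^ i * F $ i * (q ^ (n - i) * G $ (n - i))"
    if "i \<le> n" for i
  proof -
    have "q ^ n = q ^ i * q ^ (n - i)"
      using that by (simp flip: power_add)
    then show ?thesis by simp
  qed
  then show "dilate q (F * G) $ n = (dilate q F * dilate q G) $ n"
    unfolding dilate_def fps_mult_nth fps_nth_Abs_fps sum_distrib_left
    by (intro sum.cong) auto
qed

lemma dilate_linear:
  "dilate q (F + G) = dilate q F + dilate q G"
  "dilate q (F - G) = dilate q F - dilate q G"
  "dilate q (fps_const c * F) = fps_const c * dilate q F"
  unfolding dilate_def by (auto intro!: fps_ext simp: distrib_left right_diff_distrib)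

text \<open>The series t/(1 - t). Its vanishing constant term makes the partial sums strict,
  matching n_1 > n_2 > ... in the multiple sums.\<close>

definition geom :: "complex fps"
  where "geom = Abs_fps (\<lambda>n. if n = 0 then 0 else 1)"

lemma geom_mult_nth: "(geom * F) $ n = (\<Sum>m<n. F $ m)"
proof -
  have "(F * geom) $ n = (\<Sum>i=0..n. if i < n then F $ i else 0)"
    unfolding fps_mult_nth geom_def by (intro sum.cong) auto
  also have "\<dots> = (\<Sum>m<n. F $ m)"
    by (subst sum.inter_filter[symmetric]) (auto intro: sum.cong)
  finally show ?thesis
    by (simp add: mult.commute)
qed

lemma letter_op_nth_0: "letter_op q u F $ 0 = 0"
  by (cases u) (simp_all add: qint_def)

context
  fixes q :: complex
  assumes q: "norm q < 1"
begin

lemma power_neq_1: "n > 0 \<Longrightarrow> q ^ n \<noteq> 1"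
  using q power_less_one_iff[of "norm q" n] by (metis less_irrefl norm_ge_zero norm_one norm_power)

text \<open>The difference F(t) - F(qt) scales the n-th coefficient by 1 - q^n, which is nonzero for
  n > 0. Product rules can thus be checked after taking differences, with the constant terms
  compared separately.\<close>

lemma dilate_cancel:
  assumes "F - dilate q F = G - dilate q G" "F $ 0 = G $ 0"
  shows "F = G"
proof (rule fps_ext)
  fix n
  have "(1 - q ^ n) * F $ n = (1 - q ^ n) * G $ n"
    using arg_cong[OF assms(1), of "\<lambda>H. H $ n"] by (simp add: dilate_def algebra_simps)
  then show "F $ n = G $ n"
    using assms(2) power_neq_1[of n] by (cases "n = 0") auto
qed

lemma divide_qint_diff:
  assumes "n > 0"
  shows "a / qint q n - q ^ n * (a / qint q n) = (1 - q) * a"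
proof -
  have "b - q ^ n * b = b * (1 - q ^ n)" for b
    by (simp add: algebra_simps)
  also have "a / qint q n * (1 - q ^ n) = (1 - q) * a"
    using power_neq_1[OF assms] by (simp add: qint_def)
  finally show ?thesis .
qed

lemma letter_op_Rho: "letter_op q Rho F = fps_const (1 - q) * geom * F"
  by (simp add: fps_eq_iff geom_mult_nth mult.assoc)

lemma letter_op_Y:
  "letter_op q Y F - dilate q (letter_op q Y F) = fps_const (1 - q) * geom * F"
proof (rule fps_ext)
  fix n
  show "(letter_op q Y F - dilate q (letter_op q Y F)) $ n = (fps_const (1 - q) * geom * F) $ n"
  proof (cases "n = 0")
    case False
    then show ?thesis
      using divide_qint_diff[of n "\<Sum>m<n. F $ m"] by (simp add: dilate_def geom_mult_nth mult.assoc)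
  qed (simp add: dilate_def geom_def)
qed

text \<open>At n = 0 the left side is 0 and the right side is (1 - q) F_0, whence the hypothesis;
  for n > 0 the factor 1 - q^n cancels against [n].\<close>

lemma letter_op_X:
  assumes "F $ 0 = 0"
  shows "letter_op q X F - dilate q (letter_op q X F) = fps_const (1 - q) * dilate q F"
proof (rule fps_ext)
  fix n
  show "(letter_op q X F - dilate q (letter_op q X F)) $ n = (fps_const (1 - q) * dilate q F) $ n"
  proof (cases "n = 0")
    case False
    then show ?thesis
      using divide_qint_diff[of n "q ^ n * F $ n"] by (simp add: dilate_def mult.assoc)
  qed (simp add: dilate_def assms)
qed

declare letter_op.simps [simp del]

lemma fps_of_sh_corr:
  "fps_of q (sh_corr u v * h) = (case (u, v) of
      (X, X) \<Rightarrow> fps_const (1 - q) * letter_op q X (fps_of q h)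
    | (X, Y) \<Rightarrow> 0
    | (Y, X) \<Rightarrow> 0
    | (Rho, v) \<Rightarrow> - letter_op q v (letter_op q Rho (fps_of q h))
    | (u, _) \<Rightarrow> - letter_op q u (letter_op q Rho (fps_of q h)))"
proof -
  interpret L: module_hom scale "fps_scale q" "fps_of q" by (rule fps_of_hom)
  have "cscale q hbar 1 = 1 - q"
    by (simp add: cscale_def hbar_def map_poly_pCons)
  then show ?thesis
    by (cases u; cases v)
      (simp_all add: scale_mult_left L.scale L.neg xH_def yH_def \<rho>H_def mult.assoc
        fps_of_letter_mult fps_scale_def)
qed

section \<open>Product rules for the letter operators\<close>

lemma letter_op_mult_Rho_left:
  "letter_op q Rho F * G = letter_op q Rho (F * G)"
  unfolding letter_op_Rho by (simp add: mult.assoc)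

lemma letter_op_mult_Rho_right:
  "F * letter_op q Rho G = letter_op q Rho (F * G)"
  unfolding letter_op_Rho by (simp add: mult_ac)

text \<open>With c = (1 - q) t/(1 - t), expanding F'(qt) G'(qt) = (F' - cF)(G' - cG) leaves a cross
  term c^2 FG. One factor c comes from \<rho> and the other from y, which accounts for \<alpha>(y,y)
  = -y\<rho>.\<close>

lemma letter_op_mult_YY:
  "letter_op q Y F * letter_op q Y G = letter_op q Y (F * letter_op q Y G) +
    letter_op q Y (letter_op q Y F * G) - letter_op q Y (letter_op q Rho (F * G))"
proof (rule dilate_cancel)
  define c where "c = fps_const (1 - q) * geom"
  define F' G' where "F' = letter_op q Y F" and "G' = letter_op q Y G"
  have F: "dilate q F' = F' - c * F" and G: "dilate q G' = G' - c * G"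
    unfolding F'_def G'_def c_def letter_op_Y[symmetric] by simp_all
  have "F' * G' - dilate q F' * dilate q G' = c * (F * G') + c * (F' * G) - c * (c * (F * G))"
    by (simp add: F G algebra_simps)
  also have "\<dots> = (letter_op q Y (F * G') - dilate q (letter_op q Y (F * G'))) +
      (letter_op q Y (F' * G) - dilate q (letter_op q Y (F' * G))) -
      (letter_op q Y (letter_op q Rho (F * G)) - dilate q (letter_op q Y (letter_op q Rho (F * G))))"
    unfolding letter_op_Y by (simp add: letter_op_Rho c_def mult.assoc)
  finally show "F' * G' - dilate q (F' * G') =
      letter_op q Y (F * G') + letter_op q Y (F' * G) - letter_op q Y (letter_op q Rho (F * G)) -
      dilate q (letter_op q Y (F * G') + letter_op q Y (F' * G)
        - letter_op q Y (letter_op q Rho (F * G)))"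
    by (simp add: dilate_mult dilate_linear algebra_simps)
qed (simp add: letter_op_nth_0)

text \<open>The Leibniz rule is used in the asymmetric form (F' - F'(qt)) G'(qt) + F' (G' - G'(qt)).
  The difference of F' already contains F(qt), which joins G'(qt) to the dilation of FG'; no
  correction remains, as \<alpha>(x,y) = 0.\<close>

lemma letter_op_mult_XY:
  assumes "F $ 0 = 0"
  shows "letter_op q X F * letter_op q Y G = letter_op q X (F * letter_op q Y G) +
    letter_op q Y (letter_op q X F * G)"
proof (rule dilate_cancel)
  define c where "c = fps_const (1 - q)"
  define F' G' where "F' = letter_op q X F" and "G' = letter_op q Y G"
  have F: "F' - dilate q F' = c * dilate q F" and G: "G' - dilate q G' = c * geom * G"
    using letter_op_X[OF assms] letter_op_Y[of G] by (simp_all add: F'_def G'_def c_def)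
  have "F' * G' - dilate q F' * dilate q G' =
      (F' - dilate q F') * dilate q G' + F' * (G' - dilate q G')"
    by (simp add: algebra_simps)
  also have "\<dots> = c * dilate q (F * G') + c * geom * (F' * G)"
    by (simp add: F G dilate_mult mult_ac)
  also have "\<dots> = (letter_op q X (F * G') - dilate q (letter_op q X (F * G'))) +
      (letter_op q Y (F' * G) - dilate q (letter_op q Y (F' * G)))"
    using assms by (simp add: letter_op_X letter_op_Y c_def)
  finally show "F' * G' - dilate q (F' * G') =
      letter_op q X (F * G') + letter_op q Y (F' * G) -
      dilate q (letter_op q X (F * G') + letter_op q Y (F' * G))"
    by (simp add: dilate_mult dilate_linear algebra_simps)
qed (simp add: letter_op_nth_0)

text \<open>Both differences are dilated, so the product is expanded around F'(qt) and G'(qt). The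
  cross term (1 - q)^2 F(qt) G(qt) is 1 - q times the difference of the x-operator applied to FG,
  the image of \<alpha>(x,x) = \<hbar>x.\<close>

lemma letter_op_mult_XX:
  assumes "F $ 0 = 0" "G $ 0 = 0"
  shows "letter_op q X F * letter_op q X G = letter_op q X (F * letter_op q X G) +
    letter_op q X (letter_op q X F * G) + fps_const (1 - q) * letter_op q X (F * G)"
proof (rule dilate_cancel)
  define c where "c = fps_const (1 - q)"
  define F' G' where "F' = letter_op q X F" and "G' = letter_op q X G"
  have F: "F' = dilate q F' + c * dilate q F" and G: "G' = dilate q G' + c * dilate q G"
    using letter_op_X[OF assms(1)] letter_op_X[OF assms(2)]
    unfolding F'_def G'_def c_def by (metis add.commute diff_add_cancel)+
  have "F' * G' - dilate q F' * dilate q G' =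
      c * dilate q (F * G') + c * dilate q (F' * G) + c * (c * dilate q (F * G))"
  proof -
    have "a * b - a' * b' = c * (f * b') + c * (a' * g) + c * (c * (f * g))"
      if "a = a' + c * f" "b = b' + c * g" for a b a' b' f g :: "complex fps"
      unfolding that by (simp add: algebra_simps)
    from this[OF F G] show ?thesis by (simp add: dilate_mult)
  qed
  also have "\<dots> = (letter_op q X (F * G') - dilate q (letter_op q X (F * G'))) +
      (letter_op q X (F' * G) - dilate q (letter_op q X (F' * G))) +
      c * (letter_op q X (F * G) - dilate q (letter_op q X (F * G)))"
    using assms by (simp add: letter_op_X c_def)
  finally show "F' * G' - dilate q (F' * G') =
      letter_op q X (F * G') + letter_op q X (F' * G) + fps_const (1 - q) * letter_op q X (F * G) -
      dilate q (letter_op q X (F * G') + letter_op q X (F' * G)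
        + fps_const (1 - q) * letter_op q X (F * G))"
    using dilate_linear(3)[of q "1 - q" "letter_op q X (F * G)"]
    unfolding dilate_linear(1) dilate_mult[of q F' G'] c_def[symmetric]
    by (simp add: algebra_simps)
qed (simp add: letter_op_nth_0)

section \<open>The product rule for words and on the subalgebra\<close>

lemma word_fps_Nil: "word_fps q [] = 1"
  by (simp add: word_fps_def)

lemma word_fps_Cons: "word_fps q (u # w) = letter_op q u (word_fps q w)"
  by (simp add: word_fps_def)

text \<open>
  For words ending in \<open>X\<close> the product rule fails: the operator of \<open>X\<close> would have to divide the
  constant term by \<open>[0] = 0\<close>.
\<close>

lemma fps_of_sh_word:
  assumes "w = [] \<or> last w \<noteq> X" "w' = [] \<or> last w' \<noteq> X"
  shows "fps_of q (sh_word w w') = word_fps q w * word_fps q w'"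
  using assms
proof (induction w w' rule: sh_word.induct)
  case (3 u w v w')
  interpret L: module_hom scale "fps_scale q" "fps_of q" by (rule fps_of_hom)
  have 0: "word_fps q w $ 0 = 0" if "w = [] \<or> last w \<noteq> X" "w \<noteq> []" for w
    using that by (cases w) (simp_all add: word_fps_Cons letter_op_nth_0)
  have w: "w = [] \<or> last w \<noteq> X" "w' = [] \<or> last w' \<noteq> X"
    using 3(4,5) by (auto split: if_splits)
  \<comment> \<open>As \<open>u # w\<close> does not end in \<open>X\<close>, a head
    \<open>X\<close> forces \<open>w\<close> to be nonempty, so its series has no constant term and
    the rules for \<open>X\<close> apply.\<close>
  have u: "word_fps q w $ 0 = 0" if "u = X"
    using 3(4) that w by (intro 0) auto
  have v: "word_fps q w' $ 0 = 0" if "v = X"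
    using 3(5) that w by (intro 0) auto
  define F G where "F = word_fps q w" and "G = word_fps q w'"
  have IH: "fps_of q (sh_word w (v # w')) = F * letter_op q v G"
    "fps_of q (sh_word (u # w) w') = letter_op q u F * G" "fps_of q (sh_word w w') = F * G"
    using 3 w by (simp_all add: F_def G_def word_fps_Cons)
  have "letter_op q u (F * letter_op q v G) + letter_op q v (letter_op q u F * G) +
      fps_of q (sh_corr u v * sh_word w w') = letter_op q u F * letter_op q v G"
  proof (cases u; cases v)
    assume "u = X" "v = X"
    then show ?thesis
      using u v letter_op_mult_XX[of F G]
      by (simp add: IH fps_of_sh_corr flip: F_def G_def del: sh_corr.simps)
  next
    assume "u = X" "v = Y"
    then show ?thesis
      using u letter_op_mult_XY[of F G]
      by (simp add: fps_of_sh_corr flip: F_def G_def del: sh_corr.simps)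
  next
    assume "u = Y" "v = X"
    then show ?thesis
      using v letter_op_mult_XY[of G F]
      by (simp add: fps_of_sh_corr mult.commute[of F] mult.commute[of "letter_op q Y F"]
          add.commute flip: F_def G_def del: sh_corr.simps)
  next
    assume "u = Y" "v = Y"
    then show ?thesis
      using letter_op_mult_YY[of F G] by (simp add: fps_of_sh_corr IH del: sh_corr.simps)
  \<comment> \<open>If a letter is \<rho>, its operator is multiplication by a series, and one of
    the two shuffle terms cancels against the correction.\<close>
  qed (simp_all add: fps_of_sh_corr IH letter_op_mult_Rho_left letter_op_mult_Rho_right
      del: sh_corr.simps)
  then show ?case
    by (simp add: L.add fps_of_letter_mult word_fps_Cons IH F_def[symmetric] G_def[symmetric]
        del: sh_corr.simps)
next
  case (1 w)
  show ?case by (simp add: fps_of_word word_fps_Nil)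
next
  case (2 u w)
  show ?case by (simp add: fps_of_word word_fps_Nil)
qed

end

text \<open>Every generator has only words ending in y or \<rho>, and products concatenate words; so
  elements of the subalgebra meet the condition of \<open>fps_of_sh_word\<close>.\<close>

lemma H1_keys_last: "f \<in> H1 \<Longrightarrow> w \<in> Poly_Mapping.keys f \<Longrightarrow> w = [] \<or> last w \<noteq> X"
proof (induction arbitrary: w rule: H1.induct)
  case (gen g)
  have x: "xH ^ k = word (replicate k X)" for k
    by (induction k) (simp_all add: word_Nil xH_def word_mult)
  show ?case
  proof (cases g)
    case GXi
    then show ?thesis
      using gen keys_diff[of yH "\<rho>H"] by (auto simp: \<xi>H_def yH_def \<rho>H_def word_def)
  next
    case (GZ k)
    then show ?thesis
      using gen by (auto simp: zH_def x yH_def word_mult) (auto simp: word_def)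
  qed
next
  case (add f f')
  then show ?case using keys_add[of f f'] by blast
next
  case (mult f f')
  then obtain u v where "w = u @ v" "u \<in> Poly_Mapping.keys f" "v \<in> Poly_Mapping.keys f'"
    using keys_mult[of f f'] by (auto simp: plus_list_def)
  with mult.IH(1)[of u] mult.IH(2)[of v] show ?case by (cases v) auto
next
  case (const c)
  then show ?case by (auto simp: fconst_def split: if_splits)
qed

lemma fps_of_shuffle:
  assumes "norm q < 1" "f \<in> H1" "g \<in> H1"
  shows "fps_of q (f sh g) = fps_of q f * fps_of q g"
proof -
  interpret L: module_hom scale "fps_scale q" "fps_of q" by (rule fps_of_hom)
  have "fps_of q (f sh g) = (\<Sum>w\<in>Poly_Mapping.keys f. fps_scale q (Poly_Mapping.lookup f w)
      (\<Sum>w'\<in>Poly_Mapping.keys g. fps_scale q (Poly_Mapping.lookup g w') (fps_of q (sh_word w w'))))"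
    by (simp add: shuffle_def lin_ext_def L.sum L.scale)
  also have "\<dots> = (\<Sum>w\<in>Poly_Mapping.keys f. fps_scale q (Poly_Mapping.lookup f w)
      (\<Sum>w'\<in>Poly_Mapping.keys g. fps_scale q (Poly_Mapping.lookup g w')
        (word_fps q w * word_fps q w')))"
    using assms H1_keys_last by (intro sum.cong refl arg_cong2[of _ _ _ _ "fps_scale q"])
      (auto intro!: fps_of_sh_word)
  also have "\<dots> = fps_of q f * fps_of q g"
    unfolding fps_of_def lin_ext_def fps_scale_def sum_product
    unfolding sum_distrib_left by (simp only: mult_ac)
  finally show ?thesis .
qed

section \<open>Evaluation of the multiple harmonic sums\<close>

text \<open>
  \<open>nested_sum I us n\<close> is the part of the nested sum with weights \<open>I\<close> whose largest index is \<open>n\<close>;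
  the empty word is attributed to \<open>n = 0\<close>.
\<close>

fun nested_sum :: "(gen \<Rightarrow> nat \<Rightarrow> 'a) \<Rightarrow> gen list \<Rightarrow> nat \<Rightarrow> 'a::comm_ring_1" where
  "nested_sum I [] n = (if n = 0 then 1 else 0)"
| "nested_sum I (g # us) n = I g n * (\<Sum>m<n. nested_sum I us m)"

section \<open>Nested sums as sums over index tuples\<close>

definition index_tuples :: "nat \<Rightarrow> nat list set"
  where "index_tuples r = {ns. length ns = r \<and> sorted_wrt (>) ns \<and> (\<forall>n\<in>set ns. n > 0)}"

definition index_tuples_below :: "nat \<Rightarrow> nat \<Rightarrow> nat list set"
  where "index_tuples_below r N = {ns \<in> index_tuples r. \<forall>n\<in>set ns. n < N}"

lemma finite_index_tuples_below: "finite (index_tuples_below r N)"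
proof (rule finite_subset)
  show "index_tuples_below r N \<subseteq> {ns. set ns \<subseteq> {..<N} \<and> length ns = r}"
    by (auto simp: index_tuples_below_def index_tuples_def)
qed (rule finite_lists_length_eq, simp)

lemma index_tuples_below_0: "index_tuples_below 0 N = {[]}"
  by (auto simp: index_tuples_below_def index_tuples_def)

lemma index_tuples_below_Suc:
  "index_tuples_below (Suc r) N = (\<Union>n\<in>{0<..<N}. (#) n ` index_tuples_below r n)"
proof (intro equalityI subsetI)
  fix ns assume "ns \<in> index_tuples_below (Suc r) N"
  then show "ns \<in> (\<Union>n\<in>{0<..<N}. (#) n ` index_tuples_below r n)"
    by (cases ns) (auto simp: index_tuples_below_def index_tuples_def)
qed (auto simp: index_tuples_below_def index_tuples_def, metis less_trans)

text \<open>Splitting off the head index, the largest one, gives the recursion of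
  \<open>nested_sum\<close>. For nonempty words n = 0 contributes nothing since
  \<open>I g 0 = 0\<close>; for the empty word \<open>N > 0\<close> puts its value 1 at n = 0 into
  the range.\<close>

lemma sum_index_tuples_below:
  assumes "N > 0" "\<And>g. I g 0 = 0"
  shows "(\<Sum>ns\<in>index_tuples_below (length us) N. \<Prod>i<length us. I (us ! i) (ns ! i)) =
    (\<Sum>n<N. nested_sum I us n)"
  using assms(1)
proof (induction us arbitrary: N)
  case Nil
  then show ?case by (simp add: index_tuples_below_0 sum.delta)
next
  case (Cons g us)
  have "(\<Sum>ns\<in>index_tuples_below (Suc (length us)) N.
        \<Prod>i<Suc (length us). I ((g # us) ! i) (ns ! i)) =
      (\<Sum>n\<in>{0<..<N}. \<Sum>ns\<in>(#) n ` index_tuples_below (length us) n.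
        \<Prod>i<Suc (length us). I ((g # us) ! i) (ns ! i))"
    unfolding index_tuples_below_Suc
    by (rule sum.UNION_disjoint) (auto simp: finite_index_tuples_below)
  also have "\<dots> = (\<Sum>n\<in>{0<..<N}. \<Sum>ns\<in>index_tuples_below (length us) n.
        I g n * (\<Prod>i<length us. I (us ! i) (ns ! i)))"
    by (rule sum.cong[OF refl], subst sum.reindex)
      (auto simp: prod.lessThan_Suc_shift simp del: prod.lessThan_Suc)
  also have "\<dots> = (\<Sum>n\<in>{0<..<N}. nested_sum I (g # us) n)"
    using Cons.IH by (intro sum.cong) (simp_all flip: sum_distrib_left)
  also have "\<dots> = (\<Sum>n<N. nested_sum I (g # us) n)"
    by (rule sum.mono_neutral_left) (auto simp: assms(2))
  finally show ?case by simp
qed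

lemma nested_sum_norm_nonneg: "0 \<le> nested_sum (\<lambda>g n. norm (I g n)) us n"
  by (induction us arbitrary: n) (simp_all add: sum_nonneg)

lemma norm_nested_sum_le:
  fixes I :: "gen \<Rightarrow> nat \<Rightarrow> 'a::real_normed_field"
  shows "norm (nested_sum I us n) \<le> nested_sum (\<lambda>g n. norm (I g n)) us n"
proof (induction us arbitrary: n)
  case (Cons g us)
  have "norm (\<Sum>m<n. nested_sum I us m) \<le> (\<Sum>m<n. nested_sum (\<lambda>g n. norm (I g n)) us m)"
    using Cons by (rule sum_norm_le)
  then show ?case by (simp add: norm_mult mult_left_mono)
qed simp

text \<open>Any finite set of tuples lies in a truncation, whose sum of norms is a partial sum of
  the convergent series; this gives absolute convergence of the unordered sum. The truncations are
  cofinal among the finite subsets, so the ordered partial sums have the same limit.\<close>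

lemma nested_sum_infsum:
  fixes I :: "gen \<Rightarrow> nat \<Rightarrow> complex"
  assumes "\<And>g. I g 0 = 0" and summable: "summable (nested_sum (\<lambda>g n. norm (I g n)) us)"
  shows "(\<Sum>\<^sub>\<infinity>ns\<in>index_tuples (length us). \<Prod>i<length us. I (us ! i) (ns ! i)) =
    suminf (nested_sum I us)"
proof -
  let ?T = "index_tuples (length us)" and ?B = "index_tuples_below (length us)"
  let ?f = "\<lambda>ns. \<Prod>i<length us. I (us ! i) (ns ! i)"
  have exhaust: "\<exists>N>0. F \<subseteq> ?B N" if "finite F" "F \<subseteq> ?T" for F
  proof -
    have "finite (\<Union>(set ` F))"
      using that(1) by simp
    then obtain N where "\<Union>(set ` F) \<subseteq> {..<N}"
      by (metis finite_nat_iff_bounded)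
    with that(2) have "F \<subseteq> ?B (Suc N)"
      by (auto simp: index_tuples_below_def less_SucI)
    then show ?thesis by blast
  qed
  have "(\<Sum>ns\<in>F. norm (?f ns)) \<le> suminf (nested_sum (\<lambda>g n. norm (I g n)) us)"
    if "finite F" "F \<subseteq> ?T" for F
  proof -
    obtain N where N: "N > 0" "F \<subseteq> ?B N"
      using exhaust \<open>finite F\<close> \<open>F \<subseteq> ?T\<close> by blast
    have "(\<Sum>ns\<in>F. norm (?f ns)) \<le> (\<Sum>ns\<in>?B N. norm (?f ns))"
      using N(2) by (intro sum_mono2) (auto simp: finite_index_tuples_below)
    also have "\<dots> = (\<Sum>n<N. nested_sum (\<lambda>g n. norm (I g n)) us n)"
      using sum_index_tuples_below[OF N(1), of "\<lambda>g n. norm (I g n)" us] assms(1)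
      by (simp add: prod_norm)
    also have "\<dots> \<le> suminf (nested_sum (\<lambda>g n. norm (I g n)) us)"
      by (rule sum_le_suminf[OF summable]) (auto simp: nested_sum_norm_nonneg)
    finally show ?thesis .
  qed
  then have "(\<lambda>ns. norm (?f ns)) summable_on ?T"
    by (intro nonneg_bdd_above_summable_on) (auto simp: bdd_above_def)
  then have "(?f has_sum infsum ?f ?T) ?T"
    by (rule has_sum_infsum[OF abs_summable_summable])
  then have "(sum ?f \<longlongrightarrow> infsum ?f ?T) (finite_subsets_at_top ?T)"
    by (simp add: has_sum_def)
  moreover have "filterlim ?B (finite_subsets_at_top ?T) sequentially"
    unfolding filterlim_finite_subsets_at_top
  proof safe
    fix F assume "finite F" "F \<subseteq> ?T"
    then obtain N where "F \<subseteq> ?B N"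
      using exhaust by blast
    then have F: "F \<subseteq> ?B n" if "n \<ge> N" for n
      using that by (force simp: index_tuples_below_def)
    show "eventually (\<lambda>n. finite (?B n) \<and> F \<subseteq> ?B n \<and> ?B n \<subseteq> ?T) sequentially"
      unfolding eventually_sequentially
    proof (intro exI allI impI conjI)
      show "F \<subseteq> ?B n" if "n \<ge> N" for n
        using F that .
    qed (auto simp: finite_index_tuples_below, simp add: index_tuples_below_def)
  qed
  ultimately have "(\<lambda>N. sum ?f (?B N)) \<longlonglongrightarrow> infsum ?f ?T"
    by (rule filterlim_compose)
  moreover have "eventually (\<lambda>N. sum ?f (?B N) = (\<Sum>n<N. nested_sum I us n)) sequentially"
    using eventually_gt_at_top[of 0] by eventually_elim (simp add: sum_index_tuples_below assms(1))
  ultimately have "(\<lambda>N. \<Sum>n<N. nested_sum I us n) \<longlonglongrightarrow> infsum ?f ?T"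
    by (rule Lim_transform_eventually)
  then have "nested_sum I us sums infsum ?f ?T"
    by (simp add: sums_def)
  then show ?thesis
    by (simp add: sums_iff)
qed

section \<open>Growth bounds and convergence for |q| < 1\<close>

context
  fixes q :: complex
  assumes q: "norm q < 1"
begin

text \<open>A default value: \<open>qint q 0 = 0\<close> and division by zero yields zero, so sums
  may start at n = 0.\<close>

lemma Iq_0: "Iq q g 0 = 0"
  by (cases g) (simp_all add: qint_def)

text \<open>Since |1 - q^n| >= 1 - |q| for n > 0, the factors 1/[n] are bounded by \<open>B\<close>.
  The decay |q|^n comes from the numerator q^n or q^(kn) with k >= 1; for z_1, that is
  \<open>GZ 0\<close>, the numerator is 1 and only boundedness remains.\<close>

lemma norm_Iq_le:
  "\<exists>C\<ge>0. \<forall>n. norm (Iq q g n) \<le> C \<and> (admissible [g] \<longrightarrow> norm (Iq q g n) \<le> C * norm q ^ n)"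
proof -
  define B where "B = norm (1 - q) / (1 - norm q)"
  define r where "r = (case g of GXi \<Rightarrow> 1 | GZ k \<Rightarrow> Suc k)"
  have B: "B \<ge> 0"
    using q by (simp add: B_def)
  have inverse_qint: "norm (1 / qint q n) \<le> B" for n
  proof (cases "n = 0")
    case False
    have "1 - norm q \<le> 1 - norm q ^ n"
      using q False power_decreasing[of 1 n "norm q"] by simp
    also have "\<dots> \<le> norm (1 - q ^ n)"
      using norm_triangle_ineq2[of 1 "q ^ n"] by (simp add: norm_power)
    finally show ?thesis
      using q by (simp add: qint_def B_def norm_divide frac_le)
  qed (simp add: qint_def B)
  have Iq: "norm (Iq q g n) \<le> norm q ^ (case g of GXi \<Rightarrow> n | GZ k \<Rightarrow> k * n) * B ^ r" for n
  proof -
    have "norm (Iq q g n) = norm q ^ (case g of GXi \<Rightarrow> n | GZ k \<Rightarrow> k * n) * norm (1 / qint q n) ^ r"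
      by (cases g) (simp_all add: r_def norm_divide norm_mult norm_power power_one_over)
    also have "\<dots> \<le> norm q ^ (case g of GXi \<Rightarrow> n | GZ k \<Rightarrow> k * n) * B ^ r"
      by (intro mult_left_mono power_mono inverse_qint) auto
    finally show ?thesis .
  qed
  show ?thesis
  proof (intro exI[of _ "B ^ r"] conjI allI impI)
    show "0 \<le> B ^ r"
      using B by simp
    show "norm (Iq q g n) \<le> B ^ r" for n
      by (rule order.trans[OF Iq]) (use q B in \<open>simp add: mult_left_le_one_le power_le_one\<close>)
    show "norm (Iq q g n) \<le> B ^ r * norm q ^ n" if "admissible [g]" for n
    proof -
      have "n \<le> (case g of GXi \<Rightarrow> n | GZ k \<Rightarrow> k * n)"
        using that by (cases g) (auto simp: neq0_conv intro: Suc_leI elim: admissible.elims)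
      then have "norm q ^ (case g of GXi \<Rightarrow> n | GZ k \<Rightarrow> k * n) \<le> norm q ^ n"
        using q by (intro power_decreasing) auto
      then have "norm q ^ (case g of GXi \<Rightarrow> n | GZ k \<Rightarrow> k * n) * B ^ r \<le> norm q ^ n * B ^ r"
        using B by (intro mult_right_mono) auto
      with Iq[of n] show ?thesis by (simp add: mult.commute)
    qed
  qed
qed

text \<open>Bounded weights give polynomial growth; exponential growth with any base s > 1 is a
  cruder bound, but it reproduces itself under summation at the cost of a factor 1/(s - 1).\<close>

lemma sum_nested_sum_bound:
  assumes "s > 1"
  shows "\<exists>K\<ge>0. \<forall>n. (\<Sum>m<n. nested_sum (\<lambda>g n. norm (Iq q g n)) us m) \<le> K * s ^ n"
proof (induction us)
  case Nil
  have "(\<Sum>m<n. nested_sum (\<lambda>g n. norm (Iq q g n)) [] m) \<le> 1 * s ^ n" for n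
    using one_le_power[of s n] assms by (simp add: sum.delta)
  then show ?case by (intro exI[of _ 1]) simp
next
  case (Cons g us)
  then obtain K where K: "K \<ge> 0" "\<And>n. (\<Sum>m<n. nested_sum (\<lambda>g n. norm (Iq q g n)) us m) \<le> K * s ^ n"
    by blast
  obtain C where C: "C \<ge> 0" "\<And>n. norm (Iq q g n) \<le> C"
      "\<And>n. admissible [g] \<Longrightarrow> norm (Iq q g n) \<le> C * norm q ^ n"
    using norm_Iq_le[of g] by blast
  have "(\<Sum>m<n. nested_sum (\<lambda>g n. norm (Iq q g n)) (g # us) m) \<le> C * K / (s - 1) * s ^ n" for n
  proof -
    have "(\<Sum>m<n. nested_sum (\<lambda>g n. norm (Iq q g n)) (g # us) m) \<le> (\<Sum>m<n. C * (K * s ^ m))"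
      using K C(1,2) by (auto intro!: sum_mono mult_mono sum_nonneg nested_sum_norm_nonneg)
    also have "\<dots> = C * K * ((s ^ n - 1) / (s - 1))"
      using assms by (simp add: geometric_sum[symmetric] sum_distrib_left mult.assoc)
    also have "\<dots> \<le> C * K * (s ^ n / (s - 1))"
      using assms K C by (intro mult_left_mono divide_right_mono) auto
    finally show ?thesis by simp
  qed
  moreover have "C * K / (s - 1) \<ge> 0"
    using assms K C by simp
  ultimately show ?case by blast
qed

lemma summable_nested_sum:
  assumes "admissible us"
  shows "summable (nested_sum (\<lambda>g n. norm (Iq q g n)) us)"
proof (cases us)
  case Nil
  then show ?thesis
    by (auto intro!: summable_finite[of "{0}"] split: if_splits)
next
  case (Cons g vs)
  then have g: "admissible [g]"
    using assms by (cases us rule: admissible.cases) auto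
  obtain C where C: "C \<ge> 0" "\<And>n. norm (Iq q g n) \<le> C"
      "\<And>n. admissible [g] \<Longrightarrow> norm (Iq q g n) \<le> C * norm q ^ n"
    using norm_Iq_le[of g] by blast
  \<comment> \<open>The inner sum grows at most like s^n and the head decays like |q|^n, so |q| s <
    1 yields a geometric majorant. The case q = 0 is separate because 1 / |q| is then 0 by
    convention.\<close>
  obtain s where s: "s > 1" "norm q * s < 1"
  proof (cases "q = 0")
    case False
    then have "1 < 1 / norm q"
      using q by simp
    then obtain s where "1 < s" "s < 1 / norm q"
      using dense by blast
    with that[of s] False show thesis
      by (simp add: field_simps)
  qed (use that[of 2] in simp)
  obtain K where K: "K \<ge> 0" "\<And>n. (\<Sum>m<n. nested_sum (\<lambda>g n. norm (Iq q g n)) vs m) \<le> K * s ^ n"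
    using sum_nested_sum_bound[OF s(1), of vs] by blast
  have "norm (nested_sum (\<lambda>g n. norm (Iq q g n)) us n) \<le> C * K * (norm q * s) ^ n" for n
  proof -
    have "norm (Iq q g n) * (\<Sum>m<n. nested_sum (\<lambda>g n. norm (Iq q g n)) vs m) \<le>
        (C * norm q ^ n) * (K * s ^ n)"
      using C(1) C(3)[OF g] K by (intro mult_mono) (auto intro!: sum_nonneg nested_sum_norm_nonneg)
    then show ?thesis
      using nested_sum_norm_nonneg[of "Iq q" us n] Cons by (simp add: power_mult_distrib mult_ac)
  qed
  moreover have "summable (\<lambda>n. C * K * (norm q * s) ^ n)"
    using s by (intro summable_mult summable_geometric) simp
  ultimately show ?thesis
    by (rule summable_comparison_test'[where N = 0, rotated])
qed

section \<open>Z_q as evaluation of the power series at t = 1\<close>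

lemma fps_of_emb_word: "fps_of q (emb_word us) $ n = nested_sum (Iq q) us n"
proof (induction us arbitrary: n)
  case Nil
  then show ?case
    using fps_of_word[of q "[]"] by (simp add: emb_word_def word_Nil word_fps_def)
next
  case (Cons g us)
  interpret L: module_hom scale "fps_scale q" "fps_of q" by (rule fps_of_hom)
  have y: "fps_of q (yH * f) $ n = (\<Sum>m<n. fps_of q f $ m) / qint q n" for f n
    by (simp add: yH_def fps_of_letter_mult letter_op.simps)
  show ?case
  proof (cases g)
    case GXi
    have "fps_of q (\<rho>H * f) $ n = (1 - q) * (\<Sum>m<n. fps_of q f $ m)" for f
      by (simp add: \<rho>H_def fps_of_letter_mult letter_op.simps)
    then have "fps_of q (\<xi>H * f) $ n = (1 / qint q n - (1 - q)) * (\<Sum>m<n. fps_of q f $ m)" for f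
      by (simp add: \<xi>H_def left_diff_distrib L.diff y)
    \<comment> \<open>This is why \<xi> = y - \<rho> has the weight q^n/[n]; at n = 0 the inner sum
      is empty and both sides vanish.\<close>
    moreover have "1 / qint q n - (1 - q) = q ^ n / qint q n" if "n > 0"
      using divide_qint_diff[OF q that, of 1] by (simp add: algebra_simps)
    ultimately show ?thesis
      using GXi Cons by (cases "n = 0") (simp_all add: emb_word_GXi)
  next
    case (GZ k)
    have "fps_of q (emb_word (GZ k # us)) $ n =
        q ^ (k * n) / qint q n ^ Suc k * (\<Sum>m<n. fps_of q (emb_word us) $ m)"
    proof (induction k)
      case 0
      then show ?case by (simp add: emb_word_GZ_0 y)
    next
      case (Suc k)
      then show ?case
        by (simp add: emb_word_GZ_Suc xH_def fps_of_letter_mult letter_op.simps power_add mult_ac)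
    qed
    then show ?thesis
      using GZ Cons by simp
  qed
qed

text \<open>\<open>Zq\<close> is defined through \<open>inv emb\<close>, so linearity is obtained on
  the range of \<open>emb\<close>.\<close>

lemma Zq_emb_hom: "Zq q (emb (scale c f + g)) = cscale q c (Zq q (emb f)) + Zq q (emb g)"
proof -
  interpret Z: module_hom scale "cscale q" "lin_ext (cscale q) (Zq_word q)"
    by (rule lin_ext_module_hom) (rule module_cscale)
  show ?thesis by (simp add: Zq_emb Z.add Z.scale)
qed

lemma Zq_eq_suminf:
  assumes "f \<in> word_span admissible"
  shows "summable (\<lambda>n. norm (fps_of q f $ n)) \<and> Zq q f = suminf (\<lambda>n. fps_of q f $ n)"
proof -
  interpret L: module_hom scale "fps_scale q" "fps_of q" by (rule fps_of_hom)
  interpret emb: module_hom scale scale emb by (fact emb_module_hom)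
  have word: "summable (\<lambda>n. norm (fps_of q (emb_word us) $ n)) \<and>
      Zq q (emb_word us) = suminf (\<lambda>n. fps_of q (emb_word us) $ n)" if "admissible us" for us
  proof
    show "summable (\<lambda>n. norm (fps_of q (emb_word us) $ n))"
      unfolding fps_of_emb_word
      by (rule summable_comparison_test'[OF summable_nested_sum[OF that], of 0])
        (simp add: norm_nested_sum_le)
    show "Zq q (emb_word us) = suminf (\<lambda>n. fps_of q (emb_word us) $ n)"
      unfolding fps_of_emb_word Zq_emb_word Zq_word_def
      using nested_sum_infsum[OF Iq_0 summable_nested_sum[OF that]] by (simp add: index_tuples_def)
  qed
  \<comment> \<open>Membership in \<open>range emb\<close> is carried through the induction because
    the linearity of \<open>Zq\<close> depends on it.\<close>
  have "f \<in> range emb \<and> summable (\<lambda>n. norm (fps_of q f $ n)) \<and> Zq q f = suminf (\<lambda>n. fps_of q f $ n)"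
    using assms unfolding word_span_def
  proof (induction rule: H.span_induct_alt)
    case base
    then show ?case
      using Zq_emb_hom[of 1 0 0] emb.zero module.scale_one[OF module_cscale]
      by (auto simp: L.zero intro!: image_eqI[of _ _ 0])
  next
    case (step c x y)
    obtain us where us: "x = emb_word us" "admissible us"
      using step by auto
    then obtain g where g: "x = emb g"
      using emb_of_word by metis
    obtain h where h: "y = emb h"
      using step by auto
    let ?k = "cscale q c 1"
    have nth: "fps_of q (scale c x + y) $ n = ?k * fps_of q x $ n + fps_of q y $ n" for n
      by (simp add: L.add L.scale fps_scale_def)
    have x: "summable (\<lambda>n. norm (fps_of q x $ n))" "Zq q x = suminf (\<lambda>n. fps_of q x $ n)"
      and y: "summable (\<lambda>n. norm (fps_of q y $ n))" "Zq q y = suminf (\<lambda>n. fps_of q y $ n)"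
      using step us word by auto
    have "scale c x + y = emb (scale c g + h)"
      by (simp add: emb.add emb.scale g h)
    moreover have "summable (\<lambda>n. norm (fps_of q (scale c x + y) $ n))"
      unfolding nth
      by (rule summable_comparison_test'[where N = 0,
            OF summable_add[OF summable_mult[OF x(1), of "norm ?k"] y(1)]])
        (simp add: norm_triangle_le norm_mult)
    moreover have "Zq q (scale c x + y) = ?k * Zq q x + Zq q y"
      using Zq_emb_hom[of c g h] by (simp add: emb.add emb.scale g h cscale_def)
    moreover have "suminf (\<lambda>n. fps_of q (scale c x + y) $ n) = ?k * Zq q x + Zq q y"
      unfolding nth x(2) y(2) using x(1) y(1)
      by (simp add: suminf_add[symmetric] suminf_mult summable_mult summable_norm_cancel)
    ultimately show ?case by auto
  qed
  then show ?thesis by simp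
qed

end

theorem theorem2:
  fixes q :: complex and w w' :: H
  assumes "0 < norm q" and "norm q < 1"
    and "w \<in> H0_hat" and "w' \<in> H0_hat"
  shows "Zq q (w sh w') = Zq q w * Zq q w'"
proof -
  have span: "w \<in> word_span admissible" "w' \<in> word_span admissible"
    using assms(3,4) H0_hat_subset_word_span by auto
  note Z = Zq_eq_suminf[OF assms(2)]
  have "fps_of q (w sh w') = fps_of q w * fps_of q w'"
    using fps_of_shuffle[OF assms(2)] assms(3,4) H0_hat_subset_H1 by auto
  \<comment> \<open>Closure under the shuffle makes the left side an absolutely convergent series at
    t = 1.\<close>
  then have "Zq q (w sh w') = suminf (\<lambda>n. (fps_of q w * fps_of q w') $ n)"
    using Z[OF shuffle_admissible[OF span]] by simp
  also have "\<dots> = (suminf (\<lambda>n. \<Sum>i\<le>n. fps_of q w $ i * fps_of q w' $ (n - i)))"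
    by (simp add: fps_mult_nth atLeast0AtMost)
  also have "\<dots> = Zq q w * Zq q w'"
    using Z[OF span(1)] Z[OF span(2)] by (simp add: Cauchy_product)
  finally show ?thesis .
qed

end
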